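(* Let $m,n\ge 3$ be integers and let $G=(\mathcal{V},\mathcal{E})$ be the $m\times n$ toroidal graph. If $f:\mathcal{V}\to\mathbb{R}$ is harmonic at every vertex of $G$, then $f$ is constant.
   Context: The $m\times n$ toroidal graph has vertex set $\mathcal{V}=(\mathbb{Z}/m\mathbb{Z})\times(\mathbb{Z}/n\mathbb{Z})$, and each vertex $(p,q)$ is adjacent exactly to $(p\pm1,q)$ and $(p,q\pm1)$, so every vertex has degree $4$. A function $f:\mathcal{V}\to\mathbb{R}$ is harmonic at a vertex $x$ if $$f(x)=\frac{1}{\deg(x)}\sum_{\{x,y\}\in\mathcal{E}} f(y),$$ where $\deg(x)$ is the degree of $x$. *)

theory Defs
  imports "HOL-Number_Theory.Residues"
begin

text \<open>A finite simple graph is given by its set of edges, each edge being a two-element set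
  of vertices.\<close>

definition neighbours :: "'a set set \<Rightarrow> 'a \<Rightarrow> 'a set" where
  "neighbours E x = {y. {x, y} \<in> E}"

definition vertex_degree :: "'a set set \<Rightarrow> 'a \<Rightarrow> nat" where
  "vertex_degree E x = card {e \<in> E. x \<in> e}"

definition harmonic_at :: "'a set set \<Rightarrow> ('a \<Rightarrow> real) \<Rightarrow> 'a \<Rightarrow> bool" where
  "harmonic_at E f x \<longleftrightarrow> f x = 1 / real (vertex_degree E x) * (\<Sum>y\<in>neighbours E x. f y)"

text \<open>The ring of integers modulo \<open>m\<close> is \<^term>\<open>residue_ring m\<close>, whose carrier consists of the
  representatives \<open>0, \<dots>, m - 1\<close>.\<close>

definition torus_verts :: "int \<Rightarrow> int \<Rightarrow> (int \<times> int) set" where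
  "torus_verts m n = carrier (residue_ring m) \<times> carrier (residue_ring n)"

definition cyclic_step :: "int \<Rightarrow> int \<Rightarrow> int \<Rightarrow> bool" where
  "cyclic_step m p p' \<longleftrightarrow>
     p' = p \<oplus>\<^bsub>residue_ring m\<^esub> \<one>\<^bsub>residue_ring m\<^esub> \<or>
     p' = p \<ominus>\<^bsub>residue_ring m\<^esub> \<one>\<^bsub>residue_ring m\<^esub>"

definition torus_edges :: "int \<Rightarrow> int \<Rightarrow> (int \<times> int) set set" where
  "torus_edges m n = {{(p, q), (p', q')} | p q p' q'.
     (p, q) \<in> torus_verts m n \<and> (p', q') \<in> torus_verts m n \<and>
     (cyclic_step m p p' \<and> q' = q \<or> p' = p \<and> cyclic_step n q q')}"

end

theory Submission imports Defs begin

text \<open>Maximum principle: at a vertex where a harmonic function attains its maximum, the function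
  takes the same value at all neighbours. The set of maximum points is therefore closed under
  unit translations in both coordinates, and these act transitively on the torus.\<close>

text \<open>The map sending \<open>y\<close> to \<open>{x, y}\<close> is a bijection from the
  neighbours of \<open>x\<close> onto the edges through \<open>x\<close>. Thus the factor in
  \<open>harmonic_at\<close> is the reciprocal of the number of summands, and the right-hand side is
  a genuine average.\<close>

lemma vertex_degree_eq_card_neighbours:
  assumes "\<And>e. e \<in> E \<Longrightarrow> \<exists>a b. e = {a, b}"
  shows "vertex_degree E x = card (neighbours E x)"
proof -
  have "{e \<in> E. x \<in> e} = (\<lambda>y. {x, y}) ` neighbours E x"
    using assms by (fastforce simp: neighbours_def insert_commute)
  moreover have "inj_on (\<lambda>y. {x, y}) (neighbours E x)"
    by (auto simp: inj_on_def doubleton_eq_iff)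
  ultimately show ?thesis
    by (simp add: vertex_degree_def card_image)
qed

text \<open>By harmonicity the differences \<open>f x - f z\<close> over the neighbours
  \<open>z\<close> sum to zero; at a local maximum they are nonnegative, so each one
  vanishes.\<close>

lemma harmonic_at_maximum:
  assumes edges: "\<And>e. e \<in> E \<Longrightarrow> \<exists>a b. e = {a, b}"
    and fin: "finite (neighbours E x)"
    and harm: "harmonic_at E f x"
    and le: "\<And>z. z \<in> neighbours E x \<Longrightarrow> f z \<le> f x"
    and y: "y \<in> neighbours E x"
  shows "f y = f x"
proof -
  \<comment> \<open>The neighbour \<open>y\<close> makes the degree nonzero, so the division can be
    cleared; division by zero would give 0 in HOL.\<close>
  have "card (neighbours E x) > 0"
    using fin y by (auto simp: card_gt_0_iff)
  then have "real (card (neighbours E x)) * f x = (\<Sum>z\<in>neighbours E x. f z)"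
    using harm vertex_degree_eq_card_neighbours[OF edges, of E x]
    by (simp add: harmonic_at_def field_simps)
  then have "(\<Sum>z\<in>neighbours E x. f x - f z) = 0"
    by (simp add: sum_subtractf)
  then have "\<forall>z\<in>neighbours E x. f x - f z = 0"
    using fin le by (subst (asm) sum_nonneg_eq_0_iff) auto
  then show ?thesis
    using y by simp
qed

lemma torus_verts_eq: "torus_verts m n = {0..m - 1} \<times> {0..n - 1}"
  by (simp add: torus_verts_def residue_ring_def)

lemma torus_neighbours_subset: "neighbours (torus_edges m n) x \<subseteq> torus_verts m n"
  by (auto simp: neighbours_def torus_edges_def doubleton_eq_iff)

lemma cyclic_step_Suc: "cyclic_step m p ((p + 1) mod m)"
  by (simp add: cyclic_step_def residue_ring_def)

lemma torus_neighbours_Suc: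
  assumes "(p, q) \<in> torus_verts m n"
  shows "((p + 1) mod m, q) \<in> neighbours (torus_edges m n) (p, q)"
    and "(p, (q + 1) mod n) \<in> neighbours (torus_edges m n) (p, q)"
proof -
  have "((p + 1) mod m, q) \<in> torus_verts m n" "(p, (q + 1) mod n) \<in> torus_verts m n"
    using assms by (auto simp: torus_verts_eq)
  then show "((p + 1) mod m, q) \<in> neighbours (torus_edges m n) (p, q)"
    and "(p, (q + 1) mod n) \<in> neighbours (torus_edges m n) (p, q)"
    unfolding neighbours_def torus_edges_def using assms cyclic_step_Suc by blast+
qed

text \<open>Every residue is reached from \<open>a\<close> by finitely many forward steps, because
  going around the cycle replaces stepping backwards.\<close>

lemma cyclic_closed_imp_all:
  fixes m a b :: int
  assumes a: "P a" "a \<in> {0..m - 1}" and b: "b \<in> {0..m - 1}"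
    and step: "\<And>p. p \<in> {0..m - 1} \<Longrightarrow> P p \<Longrightarrow> P ((p + 1) mod m)"
  shows "P b"
proof -
  have "P ((a + int k) mod m)" for k
  proof (induction k)
    case 0
    then show ?case using a by simp
  next
    case (Suc k)
    have "(a + int k) mod m \<in> {0..m - 1}"
      using a(2) by auto
    from step[OF this Suc] show ?case
      by (simp add: mod_simps ac_simps)
  qed
  \<comment> \<open>Adding \<open>m\<close> makes the number of steps positive even if
    \<open>b < a\<close>; the walk ends at \<open>b + m\<close>, which reduces to
    \<open>b\<close>.\<close>
  from this[of "nat (b - a + m)"] show ?thesis
    using a(2) b by simp
qed

theorem theorem25:
  fixes m n :: int and f :: "int \<times> int \<Rightarrow> real"
  assumes "m \<ge> 3" and "n \<ge> 3"
    and "\<forall>x\<in>torus_verts m n. harmonic_at (torus_edges m n) f x"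
  shows "\<exists>c. \<forall>x\<in>torus_verts m n. f x = c"
proof -
  let ?V = "torus_verts m n" and ?E = "torus_edges m n"
  have fin: "finite ?V" and "(0, 0) \<in> ?V"
    using assms(1,2) by (auto simp: torus_verts_eq)
  then have "Max (f ` ?V) \<in> f ` ?V"
    by (intro Max_in) auto
  then obtain a b where ab: "(a, b) \<in> ?V" and max: "f (a, b) = Max (f ` ?V)"
    by auto
  have le: "f z \<le> f (a, b)" if "z \<in> ?V" for z
    using fin that by (simp add: max)
  \<comment> \<open>Any \<open>x\<close> with this value is itself a global maximum, so the local
    argument applies again there and the value spreads.\<close>
  have nbr: "f y = f (a, b)" if "x \<in> ?V" "f x = f (a, b)" "y \<in> neighbours ?E x" for x y
  proof -
    have "f y = f x"
    proof (rule harmonic_at_maximum[where E = ?E])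
      show "\<exists>u v. e = {u, v}" if "e \<in> ?E" for e
        using that unfolding torus_edges_def by blast
      show "finite (neighbours ?E x)"
        using fin torus_neighbours_subset by (rule finite_subset[rotated])
      show "f z \<le> f x" if "z \<in> neighbours ?E x" for z
        using le[of z] torus_neighbours_subset[of m n x] that \<open>f x = f (a, b)\<close> by auto
      show "harmonic_at ?E f x"
        using assms(3) that(1) by blast
    qed (fact that(3))
    then show ?thesis using that(2) by simp
  qed
  have "f (p, q) = f (a, b)" if "(p, q) \<in> ?V" for p q
  proof -
    have pq: "a \<in> {0..m - 1}" "b \<in> {0..n - 1}" "p \<in> {0..m - 1}" "q \<in> {0..n - 1}"
      using ab that by (auto simp: torus_verts_eq)
    \<comment> \<open>The walk goes first along the first coordinate from \<open>(a, b)\<close> to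
      \<open>(p, b)\<close>, then along the second to \<open>(p, q)\<close>.\<close>
    have "f (p, b) = f (a, b)"
    proof (rule cyclic_closed_imp_all[where P = "\<lambda>u. f (u, b) = f (a, b)"])
      show "f ((u + 1) mod m, b) = f (a, b)" if "u \<in> {0..m - 1}" "f (u, b) = f (a, b)" for u
        using nbr[OF _ that(2) torus_neighbours_Suc(1)] that(1) pq by (simp add: torus_verts_eq)
    qed (use pq in simp_all)
    show ?thesis
    proof (rule cyclic_closed_imp_all[where P = "\<lambda>v. f (p, v) = f (a, b)"])
      show "f (p, (v + 1) mod n) = f (a, b)" if "v \<in> {0..n - 1}" "f (p, v) = f (a, b)" for v
        using nbr[OF _ that(2) torus_neighbours_Suc(2)] that(1) pq by (simp add: torus_verts_eq)
    qed (fact \<open>f (p, b) = f (a, b)\<close> pq)+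
  qed
  then show ?thesis
    by (intro exI[of _ "f (a, b)"]) auto
qed

end
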